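(* For any nonzero ring $R$ and every $n\ge 2$, the full matrix ring $M_n(R)$ is not strongly $\Delta$-clean.
   Context: Rings are associative with identity, not necessarily commutative. $M_n(R)$ is the ring of $n\times n$ matrices over $R$. For a ring $S$, $U(S)$ is the group of units and $\Delta(S)=\{x\in S \mid 1-xu\in U(S)\text{ for all }u\in U(S)\}$. A ring $S$ is strongly $\Delta$-clean if every $a\in S$ can be written $a=e+d$ with $e^2=e\in S$, $d\in\Delta(S)$ and $ed=de$. *)

theory Defs
  imports "Jordan_Normal_Form.Matrix"
begin

text \<open>The set \<open>\<Delta>(S)\<close>; \<open>Units S\<close> are the elements of \<open>S\<close> with a two-sided inverse.\<close>

definition Delta :: "('a, 'b) ring_scheme \<Rightarrow> 'a set" where
  "Delta S = {x \<in> carrier S. \<forall>u \<in> Units S. \<one>\<^bsub>S\<^esub> \<ominus>\<^bsub>S\<^esub> x \<otimes>\<^bsub>S\<^esub> u \<in> Units S}"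

definition strongly_Delta_clean :: "('a, 'b) ring_scheme \<Rightarrow> bool" where
  "strongly_Delta_clean S \<longleftrightarrow>
     (\<forall>a \<in> carrier S. \<exists>e \<in> carrier S. \<exists>d \<in> Delta S.
        a = e \<oplus>\<^bsub>S\<^esub> d \<and> e \<otimes>\<^bsub>S\<^esub> e = e \<and> e \<otimes>\<^bsub>S\<^esub> d = d \<otimes>\<^bsub>S\<^esub> e)"

text \<open>
  A nonzero, not necessarily commutative, associative ring with identity is a type of class
  \<open>ring_1\<close> (the class contains the axiom \<open>0 \<noteq> 1\<close>). The library states that \<open>ring_mat\<close> is a
  ring for commutative coefficients only, although the construction does not need this.
\<close>

lemma ring_ring_mat: "ring (ring_mat TYPE('a :: ring_1) n b)"
  by (unfold_locales, insert add_inv_exists_mat, auto simp: ring_mat_def algebra_simps Units_def)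

end

theory Submission
  imports Defs
begin

text \<open>
  If a unit \<open>a\<close> equals \<open>e + d\<close> with \<open>e\<close> idempotent and \<open>d \<in> \<Delta>(S)\<close>, then
  \<open>e = (1 - d a\<^sup>-\<^sup>1) a\<close> is a unit, so \<open>e = 1\<close> and \<open>a - 1 \<in> \<Delta>(S)\<close>. Thus in a strongly
  \<open>\<Delta>\<close>-clean ring every \<open>x\<close> with \<open>x\<^sup>2 = 0\<close> lies in \<open>\<Delta>(S)\<close>, because \<open>1 + x\<close> is a unit.
  If moreover \<open>y\<^sup>2 = 0\<close> and \<open>x y x = x\<close>, then \<open>1 + y\<close> is a unit and \<open>g = x (1 + y)\<close> is
  an idempotent with \<open>g x = x\<close>; as \<open>1 - g\<close> is a unit annihilated by \<open>g\<close>, both \<open>g\<close> and \<open>x\<close>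
  vanish. In a matrix ring the matrix units \<open>x = E\<^sub>0\<^sub>1\<close> and \<open>y = E\<^sub>1\<^sub>0\<close> contradict this.
\<close>

context ring
begin

text \<open>The inverse is \<open>\<one> \<oplus> \<ominus> x\<close>: the geometric series stops
  because \<open>x \<otimes> x = \<zero>\<close>.\<close>

lemma one_plus_square_zero_Units:
  assumes x: "x \<in> carrier R" and xx: "x \<otimes> x = \<zero>"
  shows "\<one> \<oplus> x \<in> Units R"
proof -
  have "(\<one> \<oplus> x) \<otimes> (\<one> \<oplus> \<ominus> x) = \<one>" "(\<one> \<oplus> \<ominus> x) \<otimes> (\<one> \<oplus> x) = \<one>"
    using x xx by (simp_all add: l_distr r_distr l_minus r_minus a_assoc l_neg r_neg)
  moreover have "\<one> \<oplus> x \<in> carrier R" "\<one> \<oplus> \<ominus> x \<in> carrier R"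
    using x by simp_all
  ultimately show ?thesis
    unfolding Units_def by blast
qed

lemma idempotent_Units_eq_one:
  assumes e: "e \<in> Units R" and ee: "e \<otimes> e = e"
  shows "e = \<one>"
  using Units_l_cancel[OF e Units_closed[OF e] one_closed] ee Units_closed[OF e] by simp

lemma unit_minus_Delta_Units:
  assumes e: "e \<in> carrier R" and d: "d \<in> Delta R" and u: "e \<oplus> d \<in> Units R"
  shows "e \<in> Units R"
proof -
  have dc: "d \<in> carrier R"
    using d by (simp add: Delta_def)
  let ?a = "e \<oplus> d"
  have ic: "inv ?a \<in> carrier R"
    using u by simp
  have "\<one> \<ominus> d \<otimes> inv ?a \<in> Units R"
    using d u by (simp add: Delta_def)
  then have "(\<one> \<ominus> d \<otimes> inv ?a) \<otimes> ?a \<in> Units R"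
    using u by simp
  also have "(\<one> \<ominus> d \<otimes> inv ?a) \<otimes> ?a = ?a \<ominus> d \<otimes> (inv ?a \<otimes> ?a)"
    using e dc ic by (simp add: minus_eq l_distr l_minus m_assoc)
  also have "\<dots> = e"
    using e dc u by (simp add: minus_eq a_assoc r_neg)
  finally show ?thesis .
qed

lemma strongly_Delta_clean_square_zero_in_Delta:
  assumes clean: "strongly_Delta_clean R"
    and x: "x \<in> carrier R" and xx: "x \<otimes> x = \<zero>"
  shows "x \<in> Delta R"
proof -
  obtain e d where e: "e \<in> carrier R" and d: "d \<in> Delta R"
    and eq: "\<one> \<oplus> x = e \<oplus> d" and ee: "e \<otimes> e = e"
    using clean x unfolding strongly_Delta_clean_def by (meson add.m_closed one_closed)
  have "e \<in> Units R"
    using unit_minus_Delta_Units[OF e d] one_plus_square_zero_Units[OF x xx] eq by simp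
  then have "e = \<one>"
    using ee by (rule idempotent_Units_eq_one)
  then have "x = d"
    using eq x d by (simp add: Delta_def)
  then show ?thesis
    using d by simp
qed

lemma not_strongly_Delta_clean:
  assumes x: "x \<in> carrier R" and y: "y \<in> carrier R"
    and xx: "x \<otimes> x = \<zero>" and yy: "y \<otimes> y = \<zero>"
    and xyx: "x \<otimes> y \<otimes> x = x" and nz: "x \<noteq> \<zero>"
  shows "\<not> strongly_Delta_clean R"
proof
  assume "strongly_Delta_clean R"
  then have "x \<in> Delta R"
    using x xx by (rule strongly_Delta_clean_square_zero_in_Delta)
  moreover define g where "g = x \<otimes> (\<one> \<oplus> y)"
  ultimately have unit: "\<one> \<ominus> g \<in> Units R"
    using one_plus_square_zero_Units[OF y yy] by (simp add: Delta_def)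
  have g: "g \<in> carrier R"
    using x y by (simp add: g_def)
  have gx: "g \<otimes> x = x"
    using x y xx xyx by (simp add: g_def l_distr r_distr)
  have gg: "g \<otimes> g = g"
  proof -
    \<comment> \<open>Only the right factor is unfolded, so that \<open>gx\<close> can absorb its
      \<open>x\<close>.\<close>
    have "g \<otimes> g = g \<otimes> x \<otimes> (\<one> \<oplus> y)"
      using g x y by (subst (2) g_def) (simp add: m_assoc)
    then show ?thesis
      by (simp add: gx flip: g_def)
  qed
  have "(\<one> \<ominus> g) \<otimes> g = (\<one> \<ominus> g) \<otimes> \<zero>"
    using g gg by (simp add: minus_eq l_distr l_minus r_neg)
  then have "g = \<zero>"
    using Units_l_cancel[OF unit g zero_closed] by simp
  then show False
    using gx x nz by simp
qed

end

definition matrix_unit :: "nat \<Rightarrow> nat \<Rightarrow> nat \<Rightarrow> 'a :: ring_1 mat" where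
  "matrix_unit n i j = mat n n (\<lambda>(k, l). if k = i \<and> l = j then 1 else 0)"

lemma matrix_unit_carrier: "matrix_unit n i j \<in> carrier_mat n n"
  by (simp add: matrix_unit_def)

text \<open>The bound on \<open>j\<close> puts \<open>t = j\<close>, the only index that can
  contribute to an entry, inside the range of summation.\<close>

lemma matrix_unit_mult:
  assumes "j < n"
  shows "matrix_unit n i j * matrix_unit n k l =
    (if j = k then matrix_unit n i l else 0\<^sub>m n n)"
proof (rule eq_matI)
  fix r s assume "r < dim_row (if j = k then matrix_unit n i l else 0\<^sub>m n n :: 'a mat)"
    and "s < dim_col (if j = k then matrix_unit n i l else 0\<^sub>m n n :: 'a mat)"
  then have rs: "r < n" "s < n"
    by (auto simp: matrix_unit_def split: if_splits)
  then have "(matrix_unit n i j * matrix_unit n k l :: 'a mat) $$ (r, s) =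
      (\<Sum>t = 0..<n. matrix_unit n i j $$ (r, t) * matrix_unit n k l $$ (t, s))"
    by (simp add: matrix_unit_def scalar_prod_def)
  also have "\<dots> = (\<Sum>t = 0..<n. if t = j then if r = i \<and> j = k \<and> s = l then 1 else 0 else 0)"
    using rs by (intro sum.cong) (auto simp: matrix_unit_def)
  finally show "(matrix_unit n i j * matrix_unit n k l) $$ (r, s) =
      (if j = k then matrix_unit n i l else 0\<^sub>m n n :: 'a mat) $$ (r, s)"
    using rs assms by (simp add: matrix_unit_def)
qed (auto simp: matrix_unit_def)

lemma matrix_unit_nonzero:
  assumes "i < n" "j < n"
  shows "matrix_unit n i j \<noteq> (0\<^sub>m n n :: 'a :: ring_1 mat)"
proof
  assume "matrix_unit n i j = (0\<^sub>m n n :: 'a mat)"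
  then have "matrix_unit n i j $$ (i, j) = (0\<^sub>m n n :: 'a mat) $$ (i, j)"
    by simp
  then show False
    using assms by (simp add: matrix_unit_def)
qed

theorem proposition2p21:
  fixes R :: "'a :: ring_1 itself" and n :: nat
  assumes "n \<ge> 2"
  shows "\<not> strongly_Delta_clean (ring_mat R n ())"
proof -
  interpret ring "ring_mat R n ()"
    \<comment> \<open>Unfolding \<open>ring_mat_def\<close> identifies the type token
      \<open>R\<close> with \<open>TYPE('a)\<close>.\<close>
    using ring_ring_mat[where 'a = 'a and n = n and b = "()"] by (simp add: ring_mat_def)
  \<comment> \<open>As \<open>n \<ge> 2\<close>, the indices 0 and 1 are in range. Both squares
    vanish because the inner indices differ; in \<open>x \<otimes> y \<otimes> x\<close> they
    match.\<close>
  show ?thesis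
    using assms
    by (intro not_strongly_Delta_clean[of "matrix_unit n 0 1" "matrix_unit n 1 0"])
      (simp_all add: ring_mat_def matrix_unit_carrier matrix_unit_mult matrix_unit_nonzero)
qed

end
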